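(* Let $G$ be a simple mixed graph on $n$ vertices. Then the following conditions are equivalent: (i) $G$ has the AB property; (ii) if $P_{\mathcal{I}(G)}(x)=x^{2n}+c_1x^{2n-1}+c_2x^{2n-2}+\cdots+c_{2n}$ is the characteristic polynomial of $\mathcal{I}(G)$, then $c_{2k+1}=0$ for $k=0,1,\dots,n-1$; (iii) the eigenvalues of $\mathcal{I}(G)$ are symmetric with respect to the origin, i.e., if $\lambda$ is an eigenvalue of $\mathcal{I}(G)$ with multiplicity $k$, then $-\lambda$ is also an eigenvalue of $\mathcal{I}(G)$ with multiplicity $k$.
   Context: A mixed graph $G$ has a finite nonempty vertex set $V_G=\{v_1,\dots,v_n\}$, a finite set $E_G$ of (undirected) edges, each joining an unordered pair of vertices $\{u,v\}$ (a loop if $u=v$), and a finite set $\vec E_G$ of arcs, each going from $u$ to $v$ for an ordered pair $(u,v)$ of vertices (a directed loop if $u=v$); multiple edges, loops, arcs and directed loops are allowed. $G$ is simple if it has no loops, no directed loops, at most one edge joining any two vertices, and at most one arc from $u$ to $v$ for each ordered pair $(u,v)$ (an edge and arcs in both directions may coexist on the same pair of vertices). The integrated adjacency matrix $\mathcal{I}(G)$ is the real symmetric $2n\times 2n$ matrix $\begin{bmatrix}A&D\\ D^T&A\end{bmatrix}$, where $A_{ij}$ ($i\neq j$) is the number of edges joining $v_i$ and $v_j$, $A_{ii}$ is twice the number of loops at $v_i$, and $D_{ij}$ is the number of arcs from $v_i$ to $v_j$. A walk in $G$ is a sequence $u_1,e_1,u_2,\dots,e_k,u_{k+1}$ where each $e_j$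 is an edge joining $u_j,u_{j+1}$, or an arc from $u_j$ to $u_{j+1}$ (traversed forward), or an arc from $u_{j+1}$ to $u_j$ (traversed backward). An alternating walk is a walk containing at least one arc in which, starting from the first arc, successive arcs alternate between forward and backward direction. An alternating cycle is an alternating walk $W$ such that: its starting and ending vertices are the same; each edge occurs at most twice in $W$, and if an edge occurs twice then the number of arcs between its two occurrences is odd; each arc of $W$ occurs exactly once; each vertex other than the starting (= ending) vertex occurs at most twice, and if it occurs twice then the number of arcs between its two occurrences is odd; the starting vertex occurs at most thrice, and if it occurs thrice then the number of arcs between its successive occurrences is odd. An odd cycle in $G$ is a cycle consisting of edges only (no arcs) with an odd number of edges. An odd alternating cycle is an alternating cycle in which the total number of arcs and edges (its length) is odd. A loopless mixed graph has the AB property (associated-bipartite property) if it has no odd cycle and no odd alternating cycle with an even number of arcs. *)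

theory Defs
  imports "Jordan_Normal_Form.Char_Poly"
begin

record ('v, 'e, 'a) mixed_graph =
  verts :: "'v set"
  edges :: "'e set"
  ends  :: "'e \<Rightarrow> 'v set"
  arcs  :: "'a set"
  tail  :: "'a \<Rightarrow> 'v"
  head  :: "'a \<Rightarrow> 'v"

text \<open>An edge with \<open>ends G e = {u}\<close> is a loop at \<open>u\<close>.\<close>

locale mixed_graph =
  fixes G :: "('v, 'e, 'a) mixed_graph"
  assumes finite_verts: "finite (verts G)"
    and verts_nonempty: "verts G \<noteq> {}"
    and finite_edges: "finite (edges G)"
    and ends_in_verts: "e \<in> edges G \<Longrightarrow> \<exists>u\<in>verts G. \<exists>v\<in>verts G. ends G e = {u, v}"
    and finite_arcs: "finite (arcs G)"
    and tail_in_verts: "a \<in> arcs G \<Longrightarrow> tail G a \<in> verts G"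
    and head_in_verts: "a \<in> arcs G \<Longrightarrow> head G a \<in> verts G"

locale simple_mixed_graph = mixed_graph +
  assumes no_loops: "e \<in> edges G \<Longrightarrow> ends G e \<noteq> {u}"
    and no_directed_loops: "a \<in> arcs G \<Longrightarrow> tail G a \<noteq> head G a"
    and no_multiple_edges: "inj_on (ends G) (edges G)"
    and no_multiple_arcs: "inj_on (\<lambda>a. (tail G a, head G a)) (arcs G)"

definition edge_mult :: "('v, 'e, 'a) mixed_graph \<Rightarrow> 'v \<Rightarrow> 'v \<Rightarrow> nat" where
  "edge_mult G u v =
     (if u = v then 2 * card {e \<in> edges G. ends G e = {u}}
      else card {e \<in> edges G. ends G e = {u, v}})"

definition arc_mult :: "('v, 'e, 'a) mixed_graph \<Rightarrow> 'v \<Rightarrow> 'v \<Rightarrow> nat" where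
  "arc_mult G u v = card {a \<in> arcs G. tail G a = u \<and> head G a = v}"

text \<open>The list \<open>vs\<close> is the enumeration of the vertices that indexes rows and columns.\<close>

definition edge_matrix :: "('v, 'e, 'a) mixed_graph \<Rightarrow> 'v list \<Rightarrow> real mat" where
  "edge_matrix G vs =
     mat (length vs) (length vs) (\<lambda>(i, j). real (edge_mult G (vs ! i) (vs ! j)))"

definition arc_matrix :: "('v, 'e, 'a) mixed_graph \<Rightarrow> 'v list \<Rightarrow> real mat" where
  "arc_matrix G vs =
     mat (length vs) (length vs) (\<lambda>(i, j). real (arc_mult G (vs ! i) (vs ! j)))"

definition integrated_adjacency_matrix ::
    "('v, 'e, 'a) mixed_graph \<Rightarrow> 'v list \<Rightarrow> real mat" where
  "integrated_adjacency_matrix G vs =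
     four_block_mat (edge_matrix G vs) (arc_matrix G vs)
                    (transpose_mat (arc_matrix G vs)) (edge_matrix G vs)"

text \<open>
  A walk \<open>u\<^sub>1, e\<^sub>1, u\<^sub>2, \<dots>, e\<^sub>k, u\<^sub>k\<^sub>+\<^sub>1\<close> is given by its vertex list \<open>us\<close> and its list \<open>es\<close> of
  steps. A step records the direction in which an arc is traversed, which the vertices alone
  would not determine for a directed loop.
\<close>

datatype ('e, 'a) step = Via_Edge 'e | Forward 'a | Backward 'a

fun traverses :: "('v, 'e, 'a) mixed_graph \<Rightarrow> 'v \<Rightarrow> ('e, 'a) step \<Rightarrow> 'v \<Rightarrow> bool" where
  "traverses G u (Via_Edge e) v \<longleftrightarrow> e \<in> edges G \<and> ends G e = {u, v}"
| "traverses G u (Forward a) v \<longleftrightarrow> a \<in> arcs G \<and> tail G a = u \<and> head G a = v"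
| "traverses G u (Backward a) v \<longleftrightarrow> a \<in> arcs G \<and> tail G a = v \<and> head G a = u"

fun is_arc_step :: "('e, 'a) step \<Rightarrow> bool" where
  "is_arc_step (Via_Edge e) \<longleftrightarrow> False"
| "is_arc_step (Forward a) \<longleftrightarrow> True"
| "is_arc_step (Backward a) \<longleftrightarrow> True"

definition is_walk :: "('v, 'e, 'a) mixed_graph \<Rightarrow> 'v list \<Rightarrow> ('e, 'a) step list \<Rightarrow> bool" where
  "is_walk G us es \<longleftrightarrow>
     length us = length es + 1 \<and> set us \<subseteq> verts G \<and>
     (\<forall>j < length es. traverses G (us ! j) (es ! j) (us ! Suc j))"

definition is_alternating_walk ::
    "('v, 'e, 'a) mixed_graph \<Rightarrow> 'v list \<Rightarrow> ('e, 'a) step list \<Rightarrow> bool" where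
  "is_alternating_walk G us es \<longleftrightarrow>
     is_walk G us es \<and>
     (let as = filter is_arc_step es in
        as \<noteq> [] \<and>
        (\<forall>i. Suc i < length as \<longrightarrow>
           (\<exists>a b. as ! i = Forward a \<and> as ! Suc i = Backward b \<or>
                  as ! i = Backward a \<and> as ! Suc i = Forward b)))"

text \<open>
  The number of arcs among the steps \<open>i, \<dots>, j - 1\<close> (counted from 0), i.e. between the
  vertices \<open>us ! i\<close> and \<open>us ! j\<close>. If \<open>es ! i\<close> and \<open>es ! j\<close> are edges, this is also the number of
  arcs between these two steps.
\<close>

definition arcs_between :: "('e, 'a) step list \<Rightarrow> nat \<Rightarrow> nat \<Rightarrow> nat" where
  "arcs_between es i j = card {k. i \<le> k \<and> k < j \<and> is_arc_step (es ! k)}"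

definition is_alternating_cycle ::
    "('v, 'e, 'a) mixed_graph \<Rightarrow> 'v list \<Rightarrow> ('e, 'a) step list \<Rightarrow> bool" where
  "is_alternating_cycle G us es \<longleftrightarrow>
     is_alternating_walk G us es \<and>
     hd us = last us \<and>
     (\<forall>e. count_list es (Via_Edge e) \<le> 2) \<and>
     (\<forall>e i j. i < j \<and> j < length es \<and> es ! i = Via_Edge e \<and> es ! j = Via_Edge e \<longrightarrow>
        odd (arcs_between es i j)) \<and>
     (\<forall>a. count_list es (Forward a) + count_list es (Backward a) \<le> 1) \<and>
     (\<forall>v. v \<noteq> hd us \<longrightarrow> count_list us v \<le> 2) \<and>
     (\<forall>v i j. v \<noteq> hd us \<and> i < j \<and> j < length us \<and> us ! i = v \<and> us ! j = v \<longrightarrow>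
        odd (arcs_between es i j)) \<and>
     count_list us (hd us) \<le> 3 \<and>
     (\<forall>i j k. i < j \<and> j < k \<and> k < length us \<and>
        us ! i = hd us \<and> us ! j = hd us \<and> us ! k = hd us \<longrightarrow>
        odd (arcs_between es i j) \<and> odd (arcs_between es j k))"

text \<open>A loop is a cycle of length 1 and two parallel edges form a cycle of length 2.\<close>

definition is_edge_cycle ::
    "('v, 'e, 'a) mixed_graph \<Rightarrow> 'v list \<Rightarrow> ('e, 'a) step list \<Rightarrow> bool" where
  "is_edge_cycle G us es \<longleftrightarrow>
     is_walk G us es \<and> es \<noteq> [] \<and> (\<forall>s\<in>set es. \<not> is_arc_step s) \<and>
     hd us = last us \<and> distinct (tl us) \<and> distinct es"

text \<open>
  Used for loopless mixed graphs only. (A graph with a loop does not satisfy it, since a loop is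
  an odd cycle.)
\<close>

definition AB_property :: "('v, 'e, 'a) mixed_graph \<Rightarrow> bool" where
  "AB_property G \<longleftrightarrow>
     \<not> (\<exists>us es. is_edge_cycle G us es \<and> odd (length es)) \<and>
     \<not> (\<exists>us es. is_alternating_cycle G us es \<and> odd (length es) \<and>
          even (length (filter is_arc_step es)))"

end

theory Submission
  imports Defs "Jordan_Normal_Form.Schur_Decomposition"
begin

text \<open>
  The integrated adjacency matrix \<open>M\<close> is the adjacency matrix of an undirected graph \<open>H\<close> on
  two copies of the vertex set of \<open>G\<close>: each edge of \<open>G\<close> appears in both copies, and an arc from \<open>u\<close> to \<open>v\<close>
  becomes an edge from \<open>u\<close> in the first copy to \<open>v\<close> in the second. All three conditions of the
  theorem say that \<open>H\<close> is bipartite.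
  
  For the AB property, note that a walk in \<open>H\<close> changes its copy whenever it uses an arc, so that the
  arcs are traversed forward and backward in turn: walks in \<open>H\<close> project to walks in \<open>G\<close> that
  alternate. Conversely, an alternating walk lifts to \<open>H\<close>, and a closed one with an even number of
  arcs lifts to a closed walk. So a two-colouring of \<open>H\<close> rules out the forbidden odd cycles
  (\<open>two_colouring_imp_AB_property\<close>). If \<open>H\<close> is not bipartite, a shortest odd closed walk in it is a
  cycle, and the requirements on repeated vertices, edges and arcs in the definition of an alternating
  cycle express just that its lift is a cycle (\<open>AB_property_imp_no_odd_closed_walk\<close>).
  
  For the spectral conditions, the characteristic polynomial of the symmetric matrix \<open>M\<close> is a product
  of linear factors over the reals. Vanishing of the odd coefficients and symmetry of the eigenvalues
  with their multiplicities both say that the multiset of roots is invariant under negation. If \<open>H\<close> is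
  bipartite, then changing the signs of one colour class turns \<open>M\<close> into \<open>- M\<close>, which has the negated
  eigenvalues (\<open>two_colouring_imp_symmetric_spectrum\<close>). Conversely, if the multiset is invariant, then
  the traces of the odd powers of \<open>M\<close> vanish, and since the entries are nonnegative there is no closed
  walk of odd length (\<open>symmetric_spectrum_imp_no_odd_closed_walk\<close>).
\<close>

section \<open>Two-colourings and odd closed walks\<close>

definition two_colouring :: "('x \<times> 'x) set \<Rightarrow> ('x \<Rightarrow> bool) \<Rightarrow> bool" where
  "two_colouring R c \<longleftrightarrow> (\<forall>(x, y)\<in>R. c x \<noteq> c y)"

definition no_odd_closed_walk :: "('x \<times> 'x) set \<Rightarrow> bool" where
  "no_odd_closed_walk R \<longleftrightarrow> (\<forall>k x. odd k \<longrightarrow> (x, x) \<notin> R ^^ k)"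

lemma sym_relpow:
  assumes "sym R" "(x, y) \<in> R ^^ k"
  shows "(y, x) \<in> R ^^ k"
  using assms(2)
proof (induction k arbitrary: y)
  case (Suc k)
  then obtain z where "(x, z) \<in> R ^^ k" "(z, y) \<in> R" by auto
  with Suc.IH assms(1) have "(z, x) \<in> R ^^ k" "(y, z) \<in> R" by (auto dest: symD)
  then show ?case by (meson relpow_Suc_I2)
qed simp

text \<open>
  Colour a vertex by the parity of the walks that lead from it to a chosen representative of its
  connected component. Every vertex has such a walk, and two walks of different parity from the same
  vertex would combine to an odd closed walk.
\<close>

lemma no_odd_closed_walk_imp_two_colouring:
  assumes sym: "sym R" and odd: "no_odd_closed_walk R"
  shows "\<exists>c. two_colouring R c"
proof -
  define rep where "rep x = (SOME y. (x, y) \<in> R\<^sup>*)" for x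
  define c where "c x \<longleftrightarrow> (\<exists>k. even k \<and> (x, rep x) \<in> R ^^ k)" for x
  have rep: "(x, rep x) \<in> R\<^sup>*" for x
    unfolding rep_def by (rule someI[of _ x]) simp
  have "c x \<noteq> c y" if xy: "(x, y) \<in> R" for x y
  proof -
    have "(y, x) \<in> R" using xy sym by (auto dest: symD)
    then have "(x, z) \<in> R\<^sup>* \<longleftrightarrow> (y, z) \<in> R\<^sup>*" for z
      using xy by (meson converse_rtrancl_into_rtrancl)
    then have same: "rep y = rep x" unfolding rep_def by simp
    \<comment> \<open>Going from the representative to \<open>x\<close>, along the edge to \<open>y\<close> and back closes a walk.\<close>
    have parity: "odd (a + b)" if "(x, rep x) \<in> R ^^ a" "(y, rep x) \<in> R ^^ b" for a b
    proof -
      have "(rep x, x) \<in> R ^^ a" using sym_relpow[OF sym that(1)] .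
      then have "(rep x, y) \<in> R ^^ Suc a" using xy by auto
      then have "(rep x, rep x) \<in> R ^^ (Suc a + b)"
        using that(2) by (simp only: relpow_add relcompI)
      then have "even (Suc a + b)" using odd unfolding no_odd_closed_walk_def by blast
      then show ?thesis by simp
    qed
    obtain a b where ab: "(x, rep x) \<in> R ^^ a" "(y, rep x) \<in> R ^^ b"
      using rep[of x] rep[of y] unfolding same rtrancl_power by blast
    have "c x \<longleftrightarrow> even a" "c y \<longleftrightarrow> even b"
      unfolding c_def same using parity ab by (auto simp: even_add)
    then show ?thesis using parity[OF ab] by simp
  qed
  then show ?thesis unfolding two_colouring_def by blast
qed

lemma two_colouring_vimage:
  assumes "two_colouring R c" "\<And>x y. (x, y) \<in> R' \<Longrightarrow> (f x, f y) \<in> R"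
  shows "two_colouring R' (c \<circ> f)"
  using assms unfolding two_colouring_def by auto

text \<open>
  A repeated vertex would cut the closed walk into two shorter closed walks. Their lengths add up to
  an odd number, so one of them is odd, against minimality. Hence a shortest odd closed walk is a
  cycle.
\<close>

lemma shortest_odd_closed_walk:
  assumes "\<not> no_odd_closed_walk R"
  obtains f k where "odd k" "f k = f 0" "\<And>i. i < k \<Longrightarrow> (f i, f (Suc i)) \<in> R" "inj_on f {..<k}"
proof -
  define P where "P k \<longleftrightarrow> odd k \<and> (\<exists>x. (x, x) \<in> R ^^ k)" for k
  define k where "k = (LEAST k. P k)"
  have "\<exists>k. P k" using assms unfolding no_odd_closed_walk_def P_def by blast
  then have Pk: "P k" unfolding k_def by (rule LeastI_ex)
  have least: "k \<le> m" if "P m" for m unfolding k_def using that by (rule Least_le)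
  obtain f where f: "f k = f 0" "\<And>i. i < k \<Longrightarrow> (f i, f (Suc i)) \<in> R"
    using Pk unfolding P_def relpow_fun_conv by metis
  have seg: "(f i, f j) \<in> R ^^ (j - i)" if "i \<le> j" "j \<le> k" for i j
    unfolding relpow_fun_conv using that f(2) by (intro exI[of _ "\<lambda>m. f (i + m)"]) auto
  have "f i \<noteq> f j" if ij: "i < j" "j < k" for i j
  proof
    assume eq: "f i = f j"
    have inner: "(f i, f i) \<in> R ^^ (j - i)" using seg[of i j] ij eq by simp
    have "(f 0, f i) \<in> R ^^ i" "(f i, f 0) \<in> R ^^ (k - j)"
      using seg[of 0 i] seg[of j k] ij eq f(1) by auto
    then have outer: "(f 0, f 0) \<in> R ^^ (i + (k - j))"
      by (auto simp: relpow_add)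
    have "P (j - i) \<or> P (i + (k - j))"
    proof (cases "odd (j - i)")
      case True
      then show ?thesis using inner unfolding P_def by blast
    next
      case False
      moreover have "k = (j - i) + (i + (k - j))" using ij by simp
      moreover have "odd k" using Pk unfolding P_def by blast
      ultimately have "odd (i + (k - j))" by (metis even_add)
      then show ?thesis using outer unfolding P_def by blast
    qed
    then show False using least[of "j - i"] least[of "i + (k - j)"] ij by auto
  qed
  then have "inj_on f {..<k}"
    by (intro inj_onI) (metis lessThan_iff linorder_neqE_nat)
  then show ?thesis using that Pk f unfolding P_def by blast
qed

section \<open>The associated graph of a mixed graph\<close>

text \<open>
  The associated graph lives on two copies of the vertex set, told apart by a Boolean. An edge is
  lifted to each copy; an arc is lifted to a single undirected edge that joins its tail in copy
  \<open>False\<close> to its head in copy \<open>True\<close>. So \<open>moves s x t\<close> holds if the step \<open>x\<close>, taken in copy \<open>s\<close>, leads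
  to copy \<open>t\<close>: a forward step is possible in copy \<open>False\<close> only and a backward step in copy \<open>True\<close>
  only, and either of them changes the copy. This is where the alternation comes from.
\<close>

fun moves :: "bool \<Rightarrow> ('e, 'a) step \<Rightarrow> bool \<Rightarrow> bool" where
  "moves s (Via_Edge e) t \<longleftrightarrow> s = t"
| "moves s (Forward a) t \<longleftrightarrow> \<not> s \<and> t"
| "moves s (Backward a) t \<longleftrightarrow> s \<and> \<not> t"

definition assoc_adj :: "('v, 'e, 'a) mixed_graph \<Rightarrow> (('v \<times> bool) \<times> ('v \<times> bool)) set" where
  "assoc_adj G = {((u, s), (v, t)). \<exists>x. traverses G u x v \<and> moves s x t}"

fun lifts :: "bool \<Rightarrow> ('e, 'a) step list \<Rightarrow> bool \<Rightarrow> bool" where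
  "lifts s [] t \<longleftrightarrow> s = t"
| "lifts s (x # xs) t \<longleftrightarrow> (\<exists>r. moves s x r \<and> lifts r xs t)"

lemma assoc_adjI:
  "traverses G u x v \<Longrightarrow> moves s x t \<Longrightarrow> ((u, s), (v, t)) \<in> assoc_adj G"
  unfolding assoc_adj_def by auto

lemma sym_assoc_adj: "sym (assoc_adj G)"
proof (rule symI)
  fix p q assume "(p, q) \<in> assoc_adj G"
  then obtain u s v t x where [simp]: "p = (u, s)" "q = (v, t)"
    and x: "traverses G u x v" "moves s x t" unfolding assoc_adj_def by auto
  have "\<exists>y. traverses G v y u \<and> moves t y s"
  proof (cases x)
    case (Via_Edge e)
    then show ?thesis using x by (intro exI[of _ x]) auto
  next
    case (Forward a)
    then show ?thesis using x by (intro exI[of _ "Backward a"]) auto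
  next
    case (Backward a)
    then show ?thesis using x by (intro exI[of _ "Forward a"]) auto
  qed
  then show "(q, p) \<in> assoc_adj G" by (auto intro: assoc_adjI)
qed

lemma moves_parity: "moves s x t \<Longrightarrow> t \<longleftrightarrow> s \<noteq> is_arc_step x"
  by (cases x) auto

lemma lifts_parity: "lifts s es t \<Longrightarrow> t \<longleftrightarrow> s \<noteq> odd (length (filter is_arc_step es))"
  by (induction es arbitrary: s) (auto dest: moves_parity)

fun opposite :: "('e, 'a) step \<Rightarrow> ('e, 'a) step \<Rightarrow> bool" where
  "opposite (Forward a) (Backward b) \<longleftrightarrow> True"
| "opposite (Backward a) (Forward b) \<longleftrightarrow> True"
| "opposite _ _ \<longleftrightarrow> False"

lemma opposite_iff: "opposite x y \<longleftrightarrow> (\<exists>a b. x = Forward a \<and> y = Backward b \<or> x = Backward a \<and> y = Forward b)"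
  by (cases x; cases y) auto

text \<open>
  Once an arc has been traversed, the current copy remembers its direction, and the next arc can be
  lifted exactly if its direction is the other one. Only the first arc restricts the copy in which
  the walk starts.
\<close>

lemma lifts_iff_successively:
  "(\<exists>t. lifts s es t) \<longleftrightarrow>
     successively opposite (filter is_arc_step es) \<and>
     (filter is_arc_step es \<noteq> [] \<longrightarrow> (\<exists>r. moves s (hd (filter is_arc_step es)) r))"
proof (induction es arbitrary: s)
  case (Cons x xs)
  have opp: "opposite x y \<longleftrightarrow> (\<exists>r. moves s' y r)"
    if "moves s x s'" "is_arc_step x" "is_arc_step y" for s s' y
    using that by (cases x; cases y) auto
  have "\<forall>y\<in>set (filter is_arc_step xs). is_arc_step y" by simp
  then have step: "(\<exists>t. lifts s' xs t) \<longleftrightarrow> successively opposite (filter is_arc_step (x # xs))"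
    if "moves s x s'" "is_arc_step x" for s'
    unfolding Cons.IH[of s'] using opp[OF that] that(2)
    by (cases "filter is_arc_step xs") auto
  show ?case
  proof (cases "is_arc_step x")
    case True
    have "(\<exists>t. lifts s (x # xs) t) \<longleftrightarrow> (\<exists>r. moves s x r \<and> (\<exists>t. lifts r xs t))" by auto
    also have "\<dots> \<longleftrightarrow> (\<exists>r. moves s x r) \<and> successively opposite (filter is_arc_step (x # xs))"
      using step True by blast
    finally show ?thesis using True by auto
  next
    case False
    then have "moves s x r \<longleftrightarrow> r = s" for r by (cases x) auto
    then show ?thesis using Cons.IH[of s] False by auto
  qed
qed auto

lemma alternating_walk_iff_lifts:
  "is_alternating_walk G us es \<longleftrightarrow>
     is_walk G us es \<and> filter is_arc_step es \<noteq> [] \<and> (\<exists>s t. lifts s es t)"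
proof (cases "filter is_arc_step es = []")
  case False
  have "is_arc_step (hd (filter is_arc_step es))"
    using hd_in_set[OF False] by auto
  then have start: "\<exists>s r. moves s (hd (filter is_arc_step es)) r"
    by (cases "hd (filter is_arc_step es)") auto
  then show ?thesis
    unfolding is_alternating_walk_def Let_def opposite_iff[symmetric] lifts_iff_successively
    using False by (auto simp: successively_conv_nth)
qed (simp add: is_alternating_walk_def)

lemma walk_Cons:
  assumes "is_walk G us (x # es)"
  obtains u us' where "us = u # us'" "us' \<noteq> []" "traverses G u x (hd us')" "is_walk G us' es"
proof -
  obtain u v us' where us: "us = u # v # us'"
    using assms unfolding is_walk_def by (cases us; cases "tl us") auto
  have "traverses G u x v" using assms us unfolding is_walk_def by force
  moreover have "is_walk G (v # us') es"
    using assms unfolding is_walk_def us by force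
  ultimately show ?thesis using that us by auto
qed

text \<open>
  Every step of a lifted walk changes the colour.
\<close>

lemma colour_along_walk:
  assumes "two_colouring (assoc_adj G) c" "is_walk G us es" "lifts s es t"
  shows "c (last us, t) \<longleftrightarrow> c (hd us, s) \<noteq> odd (length es)"
  using assms(2,3)
proof (induction es arbitrary: us s)
  case Nil
  then show ?case by (cases us) (auto simp: is_walk_def)
next
  case (Cons x es)
  from walk_Cons[OF Cons.prems(1)] obtain u us' where us: "us = u # us'" "us' \<noteq> []"
    and x: "traverses G u x (hd us')" and w: "is_walk G us' es" by blast
  from Cons.prems(2) obtain r where r: "moves s x r" "lifts r es t" by auto
  have "((u, s), (hd us', r)) \<in> assoc_adj G" using x r unfolding assoc_adj_def by auto
  then have "c (u, s) \<noteq> c (hd us', r)" using assms(1) unfolding two_colouring_def by blast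
  then show ?case using Cons.IH[OF w r(2)] us by auto
qed

text \<open>
  A closed alternating walk with an even number of arcs returns to the copy in which it started, so
  it lifts to a closed walk of the same length, and so does a closed walk without arcs. In a
  two-coloured graph closed walks are even.
\<close>

lemma two_colouring_imp_AB_property:
  assumes c: "two_colouring (assoc_adj G) c"
  shows "AB_property G"
proof -
  have even: "even (length es)"
    if "is_walk G us es" "hd us = last us" "lifts s es t" "even (length (filter is_arc_step es))"
    for us s t and es :: "('b, 'c) step list"
    using colour_along_walk[OF c that(1,3)] lifts_parity[OF that(3)] that(2,4) by auto
  have "even (length es)" if "is_edge_cycle G us es" for us es
  proof -
    have no_arcs: "filter is_arc_step es = []"
      using that unfolding is_edge_cycle_def filter_empty_conv by blast
    then obtain t where "lifts False es t" using lifts_iff_successively[of False es] by auto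
    moreover have "is_walk G us es" "hd us = last us" using that unfolding is_edge_cycle_def by auto
    ultimately show ?thesis using even[of us es False t] no_arcs by simp
  qed
  moreover have "even (length es)"
    if cycle: "is_alternating_cycle G us es" and arcs: "even (length (filter is_arc_step es))" for us es
  proof -
    have "is_walk G us es" "hd us = last us" "\<exists>s t. lifts s es t"
      using cycle unfolding is_alternating_cycle_def alternating_walk_iff_lifts by simp_all
    then show ?thesis using even[of us es] arcs by blast
  qed
  ultimately show ?thesis unfolding AB_property_def by blast
qed

section \<open>Shortest odd closed walks and alternating cycles\<close>

text \<open>
  Here \<open>f\<close> lists the vertices of a cycle. It runs through no edge of the graph twice, in whichever
  direction; oddness excludes the degenerate cycle that goes along an edge and back.
\<close>

lemma walk_edge_injective:
  assumes odd: "odd k" and closed: "f k = f 0" and inj: "inj_on f {..<k}"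
    and ij: "i < k" "j < k" and eq: "{f i, f (Suc i)} = {f j, f (Suc j)}"
  shows "i = j"
proof -
  have same: "i = j" if "f i = f j" "i < k" "j < k" for i j
    using inj that by (auto dest: inj_onD)
  \<comment> \<open>Two different steps with the same end points would force the closed walk to have length 2.\<close>
  have False if "i < j" "j < k" "{f i, f (Suc i)} = {f j, f (Suc j)}" for i j
  proof -
    have "f i \<noteq> f j" using same that by fastforce
    then have cross: "f i = f (Suc j)" "f (Suc i) = f j" using that(3) by (auto simp: doubleton_eq_iff)
    have "Suc i = j" using same cross(2) that by force
    moreover have "Suc j = k" using same[of i "Suc j"] cross(1) that by force
    moreover from this have "i = 0" using same[of i 0] cross(1) closed that by simp
    ultimately show False using odd by auto
  qed
  from this[of i j] this[of j i] show ?thesis using ij eq by (metis linorder_neqE_nat)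
qed

lemma count_list_card: "count_list xs x = card {i. i < length xs \<and> xs ! i = x}"
  by (simp add: count_list_eq_length_filter length_filter_conv_card eq_commute)

lemma card_le_2_if_inj_bool:
  assumes "inj_on (g :: nat \<Rightarrow> bool) A"
  shows "card A \<le> 2"
  using card_inj_on_le[OF assms, of UNIV] by (simp add: card_UNIV_bool)

text \<open>
  Each arc switches between the copies, so the parity conditions in the definition of an alternating
  cycle say that two positions of a lifted walk lie in different copies.
\<close>

lemma arcs_between_parity:
  assumes "\<And>i. i < length es \<Longrightarrow> moves (s i) (es ! i) (s (Suc i))" "i \<le> j" "j \<le> length es"
  shows "odd (arcs_between es i j) \<longleftrightarrow> s i \<noteq> s j"
  using assms(2,3)
proof (induction j rule: dec_induct)
  case base
  have "{k. i \<le> k \<and> k < i \<and> is_arc_step (es ! k)} = {}" by auto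
  then have "arcs_between es i i = 0" unfolding arcs_between_def by (simp only: card.empty)
  then show ?case by simp
next
  case (step j)
  have "{k. i \<le> k \<and> k < Suc j \<and> is_arc_step (es ! k)} =
      {k. i \<le> k \<and> k < j \<and> is_arc_step (es ! k)} \<union> (if is_arc_step (es ! j) then {j} else {})"
    using step.hyps by (auto simp: less_Suc_eq)
  then have "arcs_between es i (Suc j) = arcs_between es i j + (if is_arc_step (es ! j) then 1 else 0)"
    unfolding arcs_between_def by simp
  then show ?case
    using step moves_parity[OF assms(1)[of j]] by auto
qed

lemma lifts_if_moves:
  assumes "\<And>i. i < length es \<Longrightarrow> moves (s i) (es ! i) (s (Suc i))"
  shows "lifts (s 0) es (s (length es))"
  using assms
proof (induction es arbitrary: s)
  case (Cons x es)
  have "lifts (s (Suc 0)) es (s (Suc (length es)))"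
    using Cons.IH[of "s \<circ> Suc"] Cons.prems by fastforce
  moreover have "moves (s 0) x (s (Suc 0))" using Cons.prems[of 0] by simp
  ultimately show ?case by auto
qed simp

lemma (in mixed_graph) traverses_verts:
  "traverses G u x v \<Longrightarrow> u \<in> verts G \<and> v \<in> verts G"
  using ends_in_verts tail_in_verts head_in_verts by (cases x) (fastforce simp: doubleton_eq_iff)+

text \<open>
  Project a shortest odd closed walk of the associated graph to the mixed graph. A vertex of the mixed
  graph has two copies, an edge has two lifts, one in each copy, and an arc has a single lift. Since
  the lifted cycle repeats neither vertices nor edges, a repeated vertex or edge of the projection
  must come from two different copies, which is what the definition of an alternating cycle demands.
  The starting vertex may be met a third time because the cycle also ends in it.
\<close>

lemma (in mixed_graph) AB_property_imp_no_odd_closed_walk: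
  assumes AB: "AB_property G"
  shows "no_odd_closed_walk (assoc_adj G)"
proof (rule ccontr)
  assume "\<not> ?thesis"
  then obtain f k where k: "odd k" and closed: "f k = f 0"
    and adj: "\<And>i. i < k \<Longrightarrow> (f i, f (Suc i)) \<in> assoc_adj G" and inj: "inj_on f {..<k}"
    by (rule shortest_odd_closed_walk) blast
  define v where "v i = fst (f i)" for i
  define s where "s i = snd (f i)" for i
  have f: "f i = (v i, s i)" for i unfolding v_def s_def by simp
  have "\<forall>i. \<exists>x. i < k \<longrightarrow> traverses G (v i) x (v (Suc i)) \<and> moves (s i) x (s (Suc i))"
    using adj unfolding f assoc_adj_def by fastforce
  then obtain st where st: "\<And>i. i < k \<Longrightarrow> traverses G (v i) (st i) (v (Suc i))"
      "\<And>i. i < k \<Longrightarrow> moves (s i) (st i) (s (Suc i))" by metis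
  define us where "us = map v [0..<Suc k]"
  define es where "es = map st [0..<k]"
  have len: "length es = k" "length us = Suc k" unfolding es_def us_def by simp_all
  have us_nth: "us ! i = v i" if "i \<le> k" for i
    unfolding us_def using that by (subst nth_map) (auto simp del: upt_Suc)
  have es_nth: "es ! i = st i" if "i < k" for i unfolding es_def using that by simp
  have "k > 0" using k by (simp add: odd_pos)
  have hd_us: "hd us = v 0" unfolding us_def by (subst hd_map) (auto simp del: upt_Suc)
  have last_us: "last us = v 0" unfolding us_def using f closed by (simp)
  have v_in: "v i \<in> verts G" if "i \<le> k" for i
    using that traverses_verts[OF st(1)] \<open>k > 0\<close> by (cases i) auto
  have walk: "is_walk G us es"
    unfolding is_walk_def using len us_nth es_nth st(1) v_in by (auto simp: us_def simp del: upt_Suc)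
  have moves: "moves (s i) (es ! i) (s (Suc i))" if "i < length es" for i
    using st(2) es_nth that len by simp
  have parity: "odd (arcs_between es i j) \<longleftrightarrow> s i \<noteq> s j" if "i \<le> j" "j \<le> k" for i j
    using arcs_between_parity[of es s i j] moves that len by auto
  have lifted: "lifts (s 0) es (s k)" using lifts_if_moves[of es s] moves len by auto
  have even_arcs: "even (length (filter is_arc_step es))"
    using lifts_parity[OF lifted] closed unfolding f by auto
  \<comment> \<open>The positions 0 and \<open>k\<close> must be excluded, as they carry the same lifted vertex.\<close>
  have pos: "s i \<noteq> s j" if "i < j" "j \<le> k" "(i, j) \<noteq> (0, k)" "v i = v j" for i j
  proof
    assume "s i = s j"
    then have eq: "f i = f j" using that f by simp
    then have "f i = f (if j = k then 0 else j)" using closed by auto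
    then have "i = (if j = k then 0 else j)" using inj_onD[OF inj, of i "if j = k then 0 else j"] that \<open>k > 0\<close> by auto
    then show False using that by (auto split: if_splits)
  qed
  \<comment> \<open>The lift of an edge is determined by the edge and the copy, the lift of an arc by the arc alone.\<close>
  have edge_step: "{f i, f (Suc i)} = (\<lambda>u. (u, s i)) ` ends G e" if "i < k" "st i = Via_Edge e" for i e
    using st[OF that(1)] that(2) unfolding f by auto
  have arc_step: "{f i, f (Suc i)} = {(tail G a, False), (head G a, True)}"
    if "i < k" "st i = Forward a \<or> st i = Backward a" for i a
    using st[OF that(1)] that(2) unfolding f by auto
  have edge_twice: "s i \<noteq> s j" if "i < k" "j < k" "i \<noteq> j" "st i = Via_Edge e" "st j = Via_Edge e" for i j e
    using edge_step[of i e] edge_step[of j e] walk_edge_injective[OF k closed inj, of i j] that by auto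
  have arc_once: "i = j" if "i < k" "j < k" "st i = Forward a \<or> st i = Backward a"
    "st j = Forward a \<or> st j = Backward a" for i j a
    using arc_step[of i a] arc_step[of j a] walk_edge_injective[OF k closed inj, of i j] that by auto
  show False
  proof (cases "filter is_arc_step es = []")
    case True
    then have no_arc: "\<not> is_arc_step (st i)" if "i < k" for i
      using that unfolding filter_empty_conv es_def by simp
    have level: "s i = s j" if "i \<le> k" "j \<le> k" for i j
    proof -
      have "s i = s 0" if "i \<le> k" for i
        using that
      proof (induction i)
        case (Suc i)
        then show ?case using moves_parity[OF st(2)[of i]] no_arc[of i] by simp
      qed simp
      from this[of i] this[of j] show ?thesis using that by simp
    qed
    have "distinct (tl us)"
    proof -
      have "inj_on v {1..k}"
      proof (rule inj_onI)
        fix i j assume "i \<in> {1..k}" "j \<in> {1..k}" "v i = v j"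
        then show "i = j" using pos[of i j] pos[of j i] level[of i j] by (cases i j rule: linorder_cases) auto
      qed
      moreover have "tl us = map v [1..<Suc k]" unfolding us_def by (simp add: map_tl[symmetric] tl_upt del: upt_Suc)
      ultimately show ?thesis by (auto simp: distinct_map atLeastLessThanSuc_atLeastAtMost simp del: upt_Suc)
    qed
    moreover have "distinct es"
    proof -
      have "inj_on st {0..<k}"
      proof (rule inj_onI)
        fix i j assume ij: "i \<in> {0..<k}" "j \<in> {0..<k}" "st i = st j"
        have "\<not> is_arc_step (st i)" using no_arc ij by simp
        then obtain e where "st i = Via_Edge e" by (cases "st i") auto
        then show "i = j" using edge_twice[of i j e] ij level[of i j] by auto
      qed
      then show ?thesis unfolding es_def by (simp add: distinct_map)
    qed
    ultimately have "is_edge_cycle G us es"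
      unfolding is_edge_cycle_def using walk True hd_us last_us len \<open>k > 0\<close>
      by (auto simp: filter_empty_conv)
    then show False using AB k len unfolding AB_property_def by auto
  next
    case False
    have walk': "is_alternating_walk G us es"
      unfolding alternating_walk_iff_lifts using walk False lifted by blast
    have edges_le_2: "count_list es (Via_Edge e) \<le> 2" for e
      unfolding count_list_card
    proof (rule card_le_2_if_inj_bool[of s], rule inj_onI)
      fix i j
      assume "i \<in> {i. i < length es \<and> es ! i = Via_Edge e}"
        "j \<in> {i. i < length es \<and> es ! i = Via_Edge e}" "s i = s j"
      then show "i = j" using edge_twice[of i j e] es_nth len by (cases "i = j") auto
    qed
    have edges_odd: "odd (arcs_between es i j)"
      if "i < j" "j < length es" "es ! i = Via_Edge e" "es ! j = Via_Edge e" for e i j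
      using that parity[of i j] edge_twice[of i j e] es_nth len by auto
    have arcs_le_1: "count_list es (Forward a) + count_list es (Backward a) \<le> 1" for a
    proof -
      let ?A = "{i. i < length es \<and> es ! i = Forward a}"
      let ?B = "{i. i < length es \<and> es ! i = Backward a}"
      have "card ?A + card ?B = card (?A \<union> ?B)" by (subst card_Un_disjoint) auto
      moreover have "card (?A \<union> ?B) \<le> Suc 0"
      proof -
        have fin: "finite (?A \<union> ?B)" by simp
        have "i = j" if "i \<in> ?A \<union> ?B" "j \<in> ?A \<union> ?B" for i j
          using that arc_once[of i j a] es_nth len by auto
        then show ?thesis unfolding card_le_Suc0_iff_eq[OF fin] by blast
      qed
      ultimately show ?thesis unfolding count_list_card by simp
    qed
    have start_or_2: "card {i. i < k \<and> v i = w} \<le> 2" for w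
    proof (rule card_le_2_if_inj_bool[of s], rule inj_onI)
      fix i j assume "i \<in> {i. i < k \<and> v i = w}" "j \<in> {i. i < k \<and> v i = w}" "s i = s j"
      then show "i = j" using pos[of i j] pos[of j i] by (cases i j rule: linorder_cases) auto
    qed
    have count: "count_list us w = card {i. i < k \<and> v i = w} + (if w = v 0 then 1 else 0)" for w
    proof -
      have "v k = v 0" using closed unfolding f by simp
      then have "{i. i < length us \<and> us ! i = w} =
          {i. i < k \<and> v i = w} \<union> (if w = v 0 then {k} else {})"
        unfolding len using us_nth by (auto simp: less_Suc_eq_le le_less)
      then show ?thesis unfolding count_list_card by simp
    qed
    have verts_le_2: "count_list us w \<le> 2" if "w \<noteq> hd us" for w
      using count[of w] start_or_2[of w] that hd_us by simp
    have start_le_3: "count_list us (hd us) \<le> 3"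
      using count[of "hd us"] start_or_2[of "hd us"] hd_us by simp
    have verts_odd: "odd (arcs_between es i j)"
      if "w \<noteq> hd us" "i < j" "j < length us" "us ! i = w" "us ! j = w" for w i j
    proof -
      have "v i = v j" "(i, j) \<noteq> (0, k)" using that us_nth len hd_us by auto
      then show ?thesis using parity[of i j] pos[of i j] that len by simp
    qed
    have start_odd: "odd (arcs_between es i j)" "odd (arcs_between es j l)"
      if "i < j" "j < l" "l < length us" "us ! i = hd us" "us ! j = hd us" "us ! l = hd us" for i j l
    proof -
      have "v i = v j" "v j = v l" using that us_nth len by auto
      then show "odd (arcs_between es i j)" "odd (arcs_between es j l)"
        using parity[of i j] pos[of i j] parity[of j l] pos[of j l] that len by simp_all
    qed
    have closed_us: "hd us = last us" using hd_us last_us by simp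
    have "is_alternating_cycle G us es"
      unfolding is_alternating_cycle_def
    proof (intro conjI allI impI walk' closed_us edges_le_2 arcs_le_1 start_le_3)
      show "count_list us w \<le> 2" if "w \<noteq> hd us" for w
        using verts_le_2[OF that] .
      show "odd (arcs_between es i j)"
        if "i < j \<and> j < length es \<and> es ! i = Via_Edge e \<and> es ! j = Via_Edge e" for e i j
        using edges_odd[of i j e] that by simp
      show "odd (arcs_between es i j)"
        if "w \<noteq> hd us \<and> i < j \<and> j < length us \<and> us ! i = w \<and> us ! j = w" for w i j
        using verts_odd[of w i j] that by simp
      fix i j l
      assume "i < j \<and> j < l \<and> l < length us \<and> us ! i = hd us \<and> us ! j = hd us \<and> us ! l = hd us"
      then show "odd (arcs_between es i j)" "odd (arcs_between es j l)"
        using start_odd[of i j l] by simp_all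
    qed
    then show False using AB k len even_arcs unfolding AB_property_def by auto
  qed
qed

section \<open>Real-rooted characteristic polynomials\<close>

text \<open>
  The characteristic polynomial splits over the complex numbers. If \<open>v\<close> is an eigenvector for a root
  \<open>a\<close>, the Hermitian form \<open>S = a * N\<close> of the matrix at \<open>v\<close>, where \<open>N > 0\<close> is the squared norm of
  \<open>v\<close>, equals its own conjugate by symmetry, so \<open>a\<close> is real.
\<close>

lemma real_symmetric_char_poly_splits:
  fixes A :: "real mat"
  assumes A: "A \<in> carrier_mat n n" and sym: "transpose_mat A = A"
  shows "\<exists>es. char_poly A = (\<Prod>e\<leftarrow>es. [:- e, 1:]) \<and> length es = n"
proof -
  define C where "C = map_mat complex_of_real A"
  have C: "C \<in> carrier_mat n n" using A unfolding C_def by simp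
  obtain as where as: "char_poly C = (\<Prod>a\<leftarrow>as. [:- a, 1:])" "length as = n"
    using char_poly_factorized[OF C] by blast
  have real: "of_real (Re a) = a" if "a \<in> set as" for a
  proof -
    have "poly (char_poly C) a = 0" unfolding as(1) poly_prod_list using that by (force simp: prod_list_zero_iff)
    then obtain v where "eigenvector C v a" using eigenvalue_root_char_poly[OF C] unfolding eigenvalue_def by blast
    then have v: "v \<in> carrier_vec n" "v \<noteq> 0\<^sub>v n" "C *\<^sub>v v = a \<cdot>\<^sub>v v"
      using C unfolding eigenvector_def by auto
    have row: "(\<Sum>j<n. of_real (A $$ (i, j)) * v $ j) = a * v $ i" if "i < n" for i
    proof -
      have "(C *\<^sub>v v) $ i = (\<Sum>j<n. of_real (A $$ (i, j)) * v $ j)"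
        using that v(1) A C unfolding C_def by (simp add: scalar_prod_def lessThan_atLeast0)
      then show ?thesis unfolding v(3) using that v(1) by simp
    qed
    define S where "S = (\<Sum>i<n. \<Sum>j<n. of_real (A $$ (i, j)) * v $ j * cnj (v $ i))"
    define N where "N = (\<Sum>i<n. (cmod (v $ i))\<^sup>2)"
    have sym': "A $$ (i, j) = A $$ (j, i)" if "i < n" "j < n" for i j
      using arg_cong[OF sym, of "\<lambda>B. B $$ (i, j)"] A that by simp
    have "S = (\<Sum>i<n. a * v $ i * cnj (v $ i))"
      unfolding S_def by (rule sum.cong) (simp_all add: row sum_distrib_right[symmetric])
    then have S: "S = a * of_real N"
      unfolding N_def by (simp add: sum_distrib_left mult.assoc complex_norm_square del: of_real_power)
    have "cnj S = (\<Sum>i<n. \<Sum>j<n. of_real (A $$ (i, j)) * cnj (v $ j) * v $ i)"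
      unfolding S_def by simp
    also have "\<dots> = (\<Sum>j<n. \<Sum>i<n. of_real (A $$ (i, j)) * cnj (v $ j) * v $ i)"
      by (rule sum.swap)
    also have "\<dots> = S"
      unfolding S_def by (intro sum.cong) (use sym' in \<open>simp_all add: ac_simps\<close>)
    finally have "cnj a * of_real N = a * of_real N" unfolding S by simp
    moreover have "N \<noteq> 0"
    proof -
      obtain i where "i < n" "v $ i \<noteq> 0" using v(1,2) by (metis carrier_vecD eq_vecI index_zero_vec)
      then have "N > 0" unfolding N_def by (intro sum_pos2[of _ i]) auto
      then show ?thesis by simp
    qed
    ultimately have "cnj a = a" by simp
    then show ?thesis by (simp add: complex_eq_iff)
  qed
  let ?q = "\<Prod>e\<leftarrow>map Re as. [:- e, 1:]"
  interpret of_real_poly: map_poly_comm_ring_hom complex_of_real ..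
  have hom: "map_poly complex_of_real (\<Prod>e\<leftarrow>es. [:- e, 1:]) = (\<Prod>e\<leftarrow>es. [:- of_real e, 1:])" for es
    by (induction es) (simp_all add: of_real_poly.hom_mult del: mult_pCons_left)
  have "map_poly complex_of_real (char_poly A) = char_poly C"
    unfolding C_def by (simp add: of_real_hom.char_poly_hom[OF A])
  also have "\<dots> = map_poly complex_of_real ?q"
    unfolding as(1) hom using real by (simp add: o_def cong: map_cong)
  finally have "char_poly A = ?q" by (simp add: poly_eq_iff coeff_map_poly)
  then show ?thesis using as(2) by (intro exI[of _ "map Re as"]) simp
qed

lemma proots_linear_factors:
  "proots (\<Prod>e\<leftarrow>es. [:- e, 1:]) = mset (es :: 'a :: idom list)"
proof (induction es)
  case (Cons e es)
  have "(\<Prod>e\<leftarrow>es. [:- e, 1:]) \<noteq> 0" by (auto simp: prod_list_zero_iff)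
  then show ?case using Cons.IH by (simp add: proots_mult del: mult_pCons_left)
qed simp

lemma prod_linear_factors_eq_iff:
  "(\<Prod>e\<leftarrow>es. [:- e, 1:]) = (\<Prod>e\<leftarrow>es'. [:- e, 1:]) \<longleftrightarrow> mset es = mset (es' :: 'a :: idom list)"
proof
  assume "(\<Prod>e\<leftarrow>es. [:- e, 1:]) = (\<Prod>e\<leftarrow>es'. [:- e, 1:])"
  then show "mset es = mset es'" by (metis proots_linear_factors)
next
  assume "mset es = mset es'"
  then have "mset (map (\<lambda>e. [:- e, 1:]) es) = mset (map (\<lambda>e. [:- e, 1:]) es')" by simp
  then show "(\<Prod>e\<leftarrow>es. [:- e, 1:]) = (\<Prod>e\<leftarrow>es'. [:- e, 1:])"
    by (metis prod_mset_prod_list)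
qed

section \<open>Traces of matrix powers\<close>

definition trace :: "'a :: semiring_1 mat \<Rightarrow> 'a" where
  "trace A = (\<Sum>i<dim_row A. A $$ (i, i))"

lemma trace_comm:
  fixes A B :: "'a :: comm_semiring_1 mat"
  assumes "A \<in> carrier_mat n m" "B \<in> carrier_mat m n"
  shows "trace (A * B) = trace (B * A)"
proof -
  have "trace (A * B) = (\<Sum>i<n. \<Sum>j<m. A $$ (i, j) * B $$ (j, i))"
    unfolding trace_def using assms by (simp add: scalar_prod_def lessThan_atLeast0)
  also have "\<dots> = (\<Sum>j<m. \<Sum>i<n. B $$ (j, i) * A $$ (i, j))"
    by (subst sum.swap) (simp add: mult.commute)
  also have "\<dots> = trace (B * A)"
    unfolding trace_def using assms by (simp add: scalar_prod_def lessThan_atLeast0)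
  finally show ?thesis .
qed

lemma trace_similar:
  fixes A B :: "'a :: comm_semiring_1 mat"
  assumes A: "A \<in> carrier_mat n n" and sim: "similar_mat_wit A B P Q"
  shows "trace A = trace B"
proof -
  from similar_mat_witD2[OF A sim]
  have wit: "Q * P = 1\<^sub>m n" "A = P * B * Q" "B \<in> carrier_mat n n" "P \<in> carrier_mat n n" "Q \<in> carrier_mat n n"
    by auto
  have "trace A = trace (Q * (P * B))"
    unfolding wit(2) by (rule trace_comm[of _ n n]) (use wit in auto)
  also have "Q * (P * B) = Q * P * B"
    using assoc_mult_mat[OF wit(5,4,3)] by simp
  finally show ?thesis using wit by simp
qed

lemma upper_triangular_pow:
  fixes B :: "'a :: comm_semiring_1 mat"
  assumes B: "B \<in> carrier_mat n n" and ut: "upper_triangular B"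
  shows "upper_triangular (B ^\<^sub>m k) \<and> (\<forall>i<n. (B ^\<^sub>m k) $$ (i, i) = (B $$ (i, i)) ^ k)"
proof (induction k)
  case 0
  then show ?case using B by auto
next
  case (Suc k)
  let ?C = "B ^\<^sub>m k"
  have C: "?C \<in> carrier_mat n n" using B by simp
  have entry: "(?C * B) $$ (i, j) = (\<Sum>l<n. ?C $$ (i, l) * B $$ (l, j))" if "i < n" "j < n" for i j
    using that B C by (simp add: scalar_prod_def lessThan_atLeast0 del: pow_mat.simps)
  have C0: "?C $$ (i, l) = 0" if "l < i" "i < n" for i l
    using upper_triangularD[of ?C l i] Suc that B C by (simp del: pow_mat.simps)
  have B0: "B $$ (i, l) = 0" if "l < i" "i < n" for i l
    using upper_triangularD[OF ut] that B by simp
  have "(?C * B) $$ (i, j) = 0" if "j < i" "i < n" for i j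
    unfolding entry[OF that(2) less_trans[OF that]]
  proof (rule sum.neutral, rule ballI)
    fix l assume "l \<in> {..<n}"
    then show "?C $$ (i, l) * B $$ (l, j) = 0"
      using C0[of l i] B0[of j l] that by (cases "l < i") auto
  qed
  then have "upper_triangular (?C * B)" using B C by (intro upper_triangularI) (simp del: pow_mat.simps)
  moreover have "(?C * B) $$ (i, i) = (B $$ (i, i)) ^ Suc k" if "i < n" for i
  proof -
    have "(?C * B) $$ (i, i) = (\<Sum>l<n. if l = i then ?C $$ (i, i) * B $$ (i, i) else 0)"
      unfolding entry[OF that that]
    proof (rule sum.cong[OF refl])
      fix l assume "l \<in> {..<n}"
      then show "?C $$ (i, l) * B $$ (l, i) = (if l = i then ?C $$ (i, i) * B $$ (i, i) else 0)"
        using C0[of l i] B0[of i l] that by (cases l i rule: linorder_cases) auto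
    qed
    also have "\<dots> = ?C $$ (i, i) * B $$ (i, i)" using that by simp
    finally show ?thesis using Suc that by (simp add: mult.commute)
  qed
  ultimately show ?case by simp
qed

text \<open>
  Schur decomposition makes the matrix similar to a triangular one with the eigenvalues on its
  diagonal, and the diagonal of a power of a triangular matrix consists of powers.
\<close>

lemma trace_pow_eq_sum_eigenvalues:
  fixes A :: "real mat"
  assumes A: "A \<in> carrier_mat n n" and cp: "char_poly A = (\<Prod>e\<leftarrow>es. [:- e, 1:])"
  shows "trace (A ^\<^sub>m k) = (\<Sum>e\<leftarrow>es. e ^ k)"
proof -
  obtain B P Q where schur: "schur_decomposition A es = (B, P, Q)"
    by (cases "schur_decomposition A es")
  have sim: "similar_mat_wit A B P Q" and ut: "upper_triangular B" and diag: "diag_mat B = es"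
    using schur_decomposition[OF A cp schur] by auto
  have B: "B \<in> carrier_mat n n" using similar_mat_witD2[OF A sim] by auto
  have "trace (A ^\<^sub>m k) = trace (B ^\<^sub>m k)"
    using trace_similar[OF pow_carrier_mat[OF A] similar_mat_wit_pow[OF sim]] .
  also have "\<dots> = (\<Sum>i<n. (B $$ (i, i)) ^ k)"
    unfolding trace_def using upper_triangular_pow[OF B ut, of k] B by simp
  also have "\<dots> = (\<Sum>e\<leftarrow>diag_mat B. e ^ k)"
    using B by (simp add: diag_mat_def interv_sum_list_conv_sum_set_nat o_def lessThan_atLeast0)
  finally show ?thesis unfolding diag .
qed

section \<open>Bipartite nonnegative matrices\<close>

definition support :: "'a :: zero mat \<Rightarrow> (nat \<times> nat) set" where
  "support A = {(i, j). i < dim_row A \<and> j < dim_col A \<and> A $$ (i, j) \<noteq> 0}"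

lemma pow_mat_pos_if_walk:
  fixes A :: "real mat"
  assumes A: "A \<in> carrier_mat n n" and nonneg: "\<And>i j. i < n \<Longrightarrow> j < n \<Longrightarrow> A $$ (i, j) \<ge> 0"
  shows "(\<forall>i<n. \<forall>j<n. (A ^\<^sub>m k) $$ (i, j) \<ge> 0) \<and>
         (\<forall>i<n. \<forall>j<n. (i, j) \<in> support A ^^ k \<longrightarrow> (A ^\<^sub>m k) $$ (i, j) > 0)"
proof (induction k)
  case 0
  then show ?case using A by auto
next
  case (Suc k)
  let ?C = "A ^\<^sub>m k"
  have C: "?C \<in> carrier_mat n n" using A by simp
  have entry: "(A ^\<^sub>m Suc k) $$ (i, j) = (\<Sum>l<n. ?C $$ (i, l) * A $$ (l, j))" if "i < n" "j < n" for i j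
    using that A C by (simp add: scalar_prod_def lessThan_atLeast0)
  have terms: "?C $$ (i, l) * A $$ (l, j) \<ge> 0" if "i < n" "j < n" "l < n" for i j l
    using Suc nonneg that by simp
  have "(A ^\<^sub>m Suc k) $$ (i, j) > 0" if ij: "i < n" "j < n" and walk: "(i, j) \<in> support A ^^ Suc k" for i j
  proof -
    obtain l where l: "(i, l) \<in> support A ^^ k" "(l, j) \<in> support A" using walk by auto
    then have "l < n" "A $$ (l, j) \<noteq> 0" using A unfolding support_def by auto
    then have "A $$ (l, j) > 0" using nonneg[of l j] ij by simp
    then have "?C $$ (i, l) * A $$ (l, j) > 0" using Suc l(1) ij \<open>l < n\<close> by simp
    then show ?thesis
      unfolding entry[OF ij] using \<open>l < n\<close> terms[OF ij] by (intro sum_pos2[of _ l]) auto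
  qed
  moreover have "(A ^\<^sub>m Suc k) $$ (i, j) \<ge> 0" if "i < n" "j < n" for i j
    unfolding entry[OF that] using terms[OF that] by (intro sum_nonneg) auto
  ultimately show ?case by blast
qed

text \<open>
  For odd \<open>k\<close> the trace of the \<open>k\<close>-th power is the sum of the \<open>k\<close>-th powers of the eigenvalues, in
  which opposite eigenvalues cancel. But the trace of a power of a nonnegative matrix is positive as
  soon as some closed walk of length \<open>k\<close> exists.
\<close>

lemma symmetric_spectrum_imp_no_odd_closed_walk:
  fixes A :: "real mat"
  assumes A: "A \<in> carrier_mat n n" and nonneg: "\<And>i j. i < n \<Longrightarrow> j < n \<Longrightarrow> A $$ (i, j) \<ge> 0"
    and cp: "char_poly A = (\<Prod>e\<leftarrow>es. [:- e, 1:])" and sym: "mset es = mset (map uminus es)"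
  shows "no_odd_closed_walk (support A)"
  unfolding no_odd_closed_walk_def
proof (intro allI impI notI)
  fix k i assume k: "odd k" and walk: "(i, i) \<in> support A ^^ k"
  have "mset (map (\<lambda>e. e ^ k) es) = mset (map (\<lambda>e. e ^ k) (map uminus es))"
    unfolding mset_map[of "\<lambda>e. e ^ k"] using sym by (rule arg_cong)
  then have "(\<Sum>e\<leftarrow>es. e ^ k) = (\<Sum>e\<leftarrow>map uminus es. e ^ k)"
    by (metis sum_mset_sum_list)
  also have "\<dots> = - (\<Sum>e\<leftarrow>es. e ^ k)" using k by (simp add: uminus_sum_list_map o_def)
  finally have "trace (A ^\<^sub>m k) = 0" using trace_pow_eq_sum_eigenvalues[OF A cp, of k] by simp
  moreover have "trace (A ^\<^sub>m k) > 0"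
  proof -
    obtain l where "(l, i) \<in> support A" using walk k by (cases k) auto
    then have "i < n" using A unfolding support_def by auto
    then show ?thesis
      unfolding trace_def using pow_mat_pos_if_walk[OF A nonneg, of k] walk A
      by (intro sum_pos2[of _ i]) auto
  qed
  ultimately show False by simp
qed

text \<open>
  Conjugation with the diagonal matrix \<open>S\<close> of the signs given by the colours negates exactly the
  entries whose two indices have different colours, and all other entries vanish. So the matrix is
  similar to its negative, whose eigenvalues are the negated ones.
\<close>

lemma two_colouring_imp_symmetric_spectrum:
  fixes A :: "real mat"
  assumes A: "A \<in> carrier_mat n n" and cp: "char_poly A = (\<Prod>e\<leftarrow>es. [:- e, 1:])"
    and c: "two_colouring (support A) c"
  shows "mset es = mset (map uminus es)"
proof -
  define S :: "real mat" where "S = mat n n (\<lambda>(i, j). if i = j then (if c i then 1 else - 1) else 0)"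
  have S: "S \<in> carrier_mat n n" unfolding S_def by simp
  have mult_S: "(X * S) $$ (i, j) = X $$ (i, j) * (if c j then 1 else - 1)"
    if "X \<in> carrier_mat n n" "i < n" "j < n" for X i j
  proof -
    have "(X * S) $$ (i, j) = (\<Sum>l<n. X $$ (i, l) * (if l = j then (if c l then 1 else - 1) else 0))"
      using that S by (auto simp: scalar_prod_def lessThan_atLeast0 S_def intro!: sum.cong)
    also have "\<dots> = (\<Sum>l<n. if l = j then X $$ (i, j) * (if c j then 1 else - 1) else 0)"
      by (rule sum.cong) auto
    finally show ?thesis using that by simp
  qed
  have S_mult: "(S * X) $$ (i, j) = (if c i then 1 else - 1) * X $$ (i, j)"
    if "X \<in> carrier_mat n n" "i < n" "j < n" for X i j
  proof -
    have "(S * X) $$ (i, j) = (\<Sum>l<n. (if i = l then (if c i then 1 else - 1) else 0) * X $$ (l, j))"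
      using that S by (auto simp: scalar_prod_def lessThan_atLeast0 S_def intro!: sum.cong)
    also have "\<dots> = (\<Sum>l<n. if l = i then (if c i then 1 else - 1) * X $$ (i, j) else 0)"
      by (rule sum.cong) auto
    finally show ?thesis using that by simp
  qed
  have SS: "S * S = 1\<^sub>m n"
    by (rule eq_matI) (use S mult_S[OF S] in \<open>auto simp: S_def\<close>)
  have "A $$ (i, j) = 0" if "i < n" "j < n" "c i = c j" for i j
    using c that A unfolding two_colouring_def support_def by auto
  then have "A $$ (i, j) = (S * (- A) * S) $$ (i, j)" if "i < n" "j < n" for i j
    using mult_S[of "S * (- A)" i j] S_mult[of "- A" i j] that A S by (auto simp del: index_mult_mat)
  then have "A = S * (- A) * S"
    using A S by (intro eq_matI) (auto simp del: index_mult_mat(1))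
  then have "similar_mat A (- A)"
    by (intro similar_matI[of _ _ S S n]) (use A S SS in auto)
  then have same: "char_poly A = char_poly (- A)" by (rule char_poly_similar)
  obtain B P Q where schur: "schur_decomposition A es = (B, P, Q)"
    by (cases "schur_decomposition A es")
  have sim: "similar_mat_wit A B P Q" and ut: "upper_triangular B" and diag: "diag_mat B = es"
    using schur_decomposition[OF A cp schur] by auto
  note wit = similar_mat_witD2[OF A sim]
  have "- A = P * (- B) * Q" using wit by simp
  then have "similar_mat (- A) (- B)"
    by (intro similar_matI[of _ _ P Q n]) (use wit A in auto)
  then have "char_poly (- A) = char_poly (- B)" by (rule char_poly_similar)
  also have "\<dots> = (\<Prod>e\<leftarrow>diag_mat (- B). [:- e, 1:])"
    using wit ut by (intro char_poly_upper_triangular[of _ n]) (auto simp: upper_triangular_def)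
  also have "diag_mat (- B) = map uminus es"
    unfolding diag[symmetric] using wit by (auto simp: diag_mat_def)
  finally show ?thesis using same cp prod_linear_factors_eq_iff by metis
qed

section \<open>Symmetric root multisets\<close>

lemma reflect_prod_linear_factors:
  "pcompose (\<Prod>e\<leftarrow>es. [:- e, 1:]) [:0, - 1:] =
     Polynomial.smult ((- 1) ^ length es) (\<Prod>e\<leftarrow>map uminus es. [:- e, 1 :: 'a :: comm_ring_1:])"
proof (induction es)
  case (Cons e es)
  have "pcompose [:- e, 1:] [:0, - 1:] = - [:- (- e), 1:]" by (simp add: pcompose_pCons)
  then show ?case
    using Cons.IH by (simp add: pcompose_mult del: mult_pCons_left mult_pCons_right minus_pCons pcompose_pCons)
qed (simp add: pcompose_1)

text \<open>
  The odd coefficients of a polynomial vanish exactly if it is invariant under \<open>x \<mapsto> - x\<close>. This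
  substitution negates the roots, and as the degree is even it keeps the polynomial monic.
\<close>

lemma odd_coeffs_eq_0_iff_mset_symmetric:
  fixes es :: "real list"
  assumes p: "p = (\<Prod>e\<leftarrow>es. [:- e, 1:])" and len: "length es = 2 * n"
  shows "(\<forall>k<n. coeff p (2 * n - (2 * k + 1)) = 0) \<longleftrightarrow> mset es = mset (map uminus es)"
proof -
  have deg: "degree p = 2 * n" unfolding p by (simp add: degree_linear_factors len)
  have "mset es = mset (map uminus es) \<longleftrightarrow> p = pcompose p [:0, - 1:]"
    unfolding p reflect_prod_linear_factors prod_linear_factors_eq_iff[symmetric] len by simp
  also have "\<dots> \<longleftrightarrow> (\<forall>i. coeff p i = (- 1) ^ i * coeff p i)"
    by (simp add: poly_eq_iff coeff_pcompose_linear)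
  also have "\<dots> \<longleftrightarrow> (\<forall>i. odd i \<longrightarrow> coeff p i = 0)"
  proof (intro all_cong1)
    fix i show "coeff p i = (- 1) ^ i * coeff p i \<longleftrightarrow> (odd i \<longrightarrow> coeff p i = 0)"
      by (cases "even i") auto
  qed
  also have "\<dots> \<longleftrightarrow> (\<forall>k<n. coeff p (2 * n - (2 * k + 1)) = 0)"
  proof
    assume "\<forall>i. odd i \<longrightarrow> coeff p i = 0"
    then show "\<forall>k<n. coeff p (2 * n - (2 * k + 1)) = 0" by auto
  next
    assume zero: "\<forall>k<n. coeff p (2 * n - (2 * k + 1)) = 0"
    show "\<forall>i. odd i \<longrightarrow> coeff p i = 0"
    proof (intro allI impI)
      fix i :: nat assume "odd i"
      then obtain m where i: "i = 2 * m + 1" by (elim oddE)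
      show "coeff p i = 0"
      proof (cases "m < n")
        case True
        then have "n - 1 - m < n" "2 * n - (2 * (n - 1 - m) + 1) = i" unfolding i by auto
        then show ?thesis using zero by metis
      next
        case False
        then show ?thesis using deg i by (intro coeff_eq_0) simp
      qed
    qed
  qed
  finally show ?thesis by blast
qed

lemma eigenvalues_symmetric_iff_mset_symmetric:
  fixes A :: "real mat"
  assumes A: "A \<in> carrier_mat n n" and cp: "char_poly A = (\<Prod>e\<leftarrow>es. [:- e, 1:])"
  shows "(\<forall>x k. eigenvalue A x \<and> Polynomial.order x (char_poly A) = k \<longrightarrow>
            eigenvalue A (- x) \<and> Polynomial.order (- x) (char_poly A) = k) \<longleftrightarrow>
         mset es = mset (map uminus es)"
proof -
  define c where "c = count (mset es)"
  have nonzero: "char_poly A \<noteq> 0" unfolding cp by (auto simp: prod_list_zero_iff)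
  then have mult: "Polynomial.order x (char_poly A) = c x" for x
    unfolding c_def using proots_linear_factors[of es] cp by (metis count_proots)
  have eigen: "eigenvalue A x \<longleftrightarrow> c x > 0" for x
    unfolding eigenvalue_root_char_poly[OF A] mult[symmetric] using nonzero by (simp add: order_root)
  have neg: "count (mset (map uminus es)) x = c (- x)" for x
    unfolding c_def by (induction es) (auto simp: minus_equation_iff)
  have "mset es = mset (map uminus es) \<longleftrightarrow> (\<forall>x. c x = c (- x))"
    unfolding multiset_eq_iff neg c_def ..
  also have "\<dots> \<longleftrightarrow> (\<forall>x. c x > 0 \<longrightarrow> c (- x) = c x)"
    by (metis minus_minus neq0_conv)
  finally show ?thesis unfolding eigen mult by auto
qed

section \<open>The integrated adjacency matrix\<close>

lemma (in mixed_graph) assoc_adj_iff: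
  "((u, s), (v, t)) \<in> assoc_adj G \<longleftrightarrow>
     (if s = t then edge_mult G u v \<noteq> 0 else if s then arc_mult G v u \<noteq> 0 else arc_mult G u v \<noteq> 0)"
proof -
  have card: "card {x \<in> S. P x} \<noteq> 0 \<longleftrightarrow> (\<exists>x\<in>S. P x)" if "finite S" for S :: "'x set" and P
    using that by (subst card_0_eq) auto
  have edge: "edge_mult G u v \<noteq> 0 \<longleftrightarrow> (\<exists>e\<in>edges G. ends G e = {u, v})"
    using card[OF finite_edges, of "\<lambda>e. ends G e = {u, v}"] unfolding edge_mult_def
    by (cases "u = v") simp_all
  have arc: "arc_mult G u v \<noteq> 0 \<longleftrightarrow> (\<exists>a\<in>arcs G. tail G a = u \<and> head G a = v)" for u v
    unfolding arc_mult_def by (rule card[OF finite_arcs])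
  have step: "(\<exists>x. P x) \<longleftrightarrow> (\<exists>e. P (Via_Edge e)) \<or> (\<exists>a. P (Forward a)) \<or> (\<exists>a. P (Backward a))"
    for P :: "('e, 'a) step \<Rightarrow> bool"
    by (metis step.exhaust)
  show ?thesis unfolding edge arc assoc_adj_def by (auto simp: step)
qed

text \<open>
  The block rows and block columns of the integrated adjacency matrix are the two copies of the
  vertex set; copy \<open>False\<close> comes first because the upper right block has the tails as rows.
\<close>

definition index_vertex :: "'v list \<Rightarrow> nat \<Rightarrow> 'v \<times> bool" where
  "index_vertex vs i = (if i < length vs then (vs ! i, False) else (vs ! (i - length vs), True))"

lemma integrated_adjacency_matrix_carrier:
  "integrated_adjacency_matrix G vs \<in> carrier_mat (2 * length vs) (2 * length vs)"
  unfolding integrated_adjacency_matrix_def edge_matrix_def arc_matrix_def by (simp add: mult_2)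

lemma integrated_adjacency_matrix_entry:
  assumes "i < 2 * length vs" "j < 2 * length vs"
  shows "integrated_adjacency_matrix G vs $$ (i, j) =
     (case (index_vertex vs i, index_vertex vs j) of ((u, s), (v, t)) \<Rightarrow>
        real (if s = t then edge_mult G u v else if s then arc_mult G v u else arc_mult G u v))"
  using assms unfolding integrated_adjacency_matrix_def edge_matrix_def arc_matrix_def index_vertex_def
  by auto

lemma transpose_integrated_adjacency_matrix:
  "transpose_mat (integrated_adjacency_matrix G vs) = integrated_adjacency_matrix G vs"
proof -
  have edge: "edge_mult G u v = edge_mult G v u" for u v
    unfolding edge_mult_def by (simp add: insert_commute)
  show ?thesis
    by (rule eq_matI)
      (use integrated_adjacency_matrix_carrier[of G vs] edge in
        \<open>auto simp: integrated_adjacency_matrix_entry split: prod.splits\<close>)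
qed

lemma (in mixed_graph) support_integrated_adjacency_matrix:
  "(i, j) \<in> support (integrated_adjacency_matrix G vs) \<longleftrightarrow>
     i < 2 * length vs \<and> j < 2 * length vs \<and> (index_vertex vs i, index_vertex vs j) \<in> assoc_adj G"
  using integrated_adjacency_matrix_carrier[of G vs]
  unfolding support_def
  by (cases "index_vertex vs i"; cases "index_vertex vs j")
    (auto simp: integrated_adjacency_matrix_entry assoc_adj_iff)

lemma (in mixed_graph) two_colouring_assoc_adj_iff_support:
  assumes vs: "set vs = verts G"
  shows "(\<exists>c. two_colouring (assoc_adj G) c) \<longleftrightarrow>
         (\<exists>c. two_colouring (support (integrated_adjacency_matrix G vs)) c)"
proof
  assume "\<exists>c. two_colouring (assoc_adj G) c"
  then show "\<exists>c. two_colouring (support (integrated_adjacency_matrix G vs)) c"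
    using two_colouring_vimage[of "assoc_adj G" _ _ "index_vertex vs"]
      support_integrated_adjacency_matrix by blast
next
  let ?I = "{..<2 * length vs}"
  define ind where "ind = inv_into ?I (index_vertex vs)"
  have onto: "(v, s) \<in> index_vertex vs ` ?I" if "v \<in> verts G" for v s
  proof -
    have "v \<in> set vs" using that vs by simp
    then obtain i where "i < length vs" "vs ! i = v" unfolding in_set_conv_nth by blast
    then show ?thesis
      unfolding index_vertex_def
      by (intro image_eqI[of _ _ "if s then length vs + i else i"]) auto
  qed
  have ind: "index_vertex vs (ind (v, s)) = (v, s)" "ind (v, s) < 2 * length vs" if "v \<in> verts G" for v s
    using f_inv_into_f[OF onto[OF that]] inv_into_into[OF onto[OF that]] unfolding ind_def by auto
  assume "\<exists>c. two_colouring (support (integrated_adjacency_matrix G vs)) c"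
  moreover have "(ind x, ind y) \<in> support (integrated_adjacency_matrix G vs)" if "(x, y) \<in> assoc_adj G" for x y
  proof -
    obtain u s v t where xy: "x = (u, s)" "y = (v, t)" by (cases x; cases y)
    then obtain st where "traverses G u st v" using \<open>(x, y) \<in> assoc_adj G\<close> unfolding assoc_adj_def by auto
    then have "u \<in> verts G" "v \<in> verts G" using traverses_verts by auto
    then show ?thesis using that ind xy unfolding support_integrated_adjacency_matrix by simp
  qed
  ultimately show "\<exists>c. two_colouring (assoc_adj G) c" using two_colouring_vimage by blast
qed

lemma sym_support:
  assumes "transpose_mat A = A"
  shows "sym (support A)"
proof (rule symI)
  fix i j assume "(i, j) \<in> support A"
  moreover from this have "A $$ (i, j) = A $$ (j, i)"
    using assms unfolding support_def by (metis (mono_tags, lifting) case_prodD index_transpose_mat mem_Collect_eq)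
  moreover have "dim_row A = dim_col A" using assms by (metis index_transpose_mat(2))
  ultimately show "(j, i) \<in> support A" unfolding support_def by auto
qed

section \<open>Characterisation of the AB property\<close>

theorem theorem4p5:
  fixes G :: "('v, 'e, 'a) mixed_graph" and vs :: "'v list" and n :: nat
  assumes "simple_mixed_graph G"
    and "distinct vs" and "set vs = verts G" and "length vs = n"
  defines "M \<equiv> integrated_adjacency_matrix G vs"
  shows "(AB_property G \<longleftrightarrow> (\<forall>k<n. coeff (char_poly M) (2 * n - (2 * k + 1)) = 0)) \<and>
         ((\<forall>k<n. coeff (char_poly M) (2 * n - (2 * k + 1)) = 0) \<longleftrightarrow>
          (\<forall>x k. eigenvalue M x \<and> Polynomial.order x (char_poly M) = k \<longrightarrow>
                 eigenvalue M (- x) \<and> Polynomial.order (- x) (char_poly M) = k))"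
proof -
  interpret simple_mixed_graph G by fact
  have M: "M \<in> carrier_mat (2 * n) (2 * n)"
    using integrated_adjacency_matrix_carrier[of G vs] assms(4) unfolding M_def by simp
  have sym: "transpose_mat M = M" unfolding M_def by (rule transpose_integrated_adjacency_matrix)
  have nonneg: "M $$ (i, j) \<ge> 0" if "i < 2 * n" "j < 2 * n" for i j
    using that assms(4) unfolding M_def by (simp add: integrated_adjacency_matrix_entry split: prod.splits)
  obtain es where es: "char_poly M = (\<Prod>e\<leftarrow>es. [:- e, 1:])" "length es = 2 * n"
    using real_symmetric_char_poly_splits[OF M sym] by blast
  \<comment> \<open>Bipartiteness of the associated graph, in terms of \<open>G\<close> and then in terms of the eigenvalues \<open>es\<close>.\<close>
  have "AB_property G \<longleftrightarrow> (\<exists>c. two_colouring (assoc_adj G) c)"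
    using two_colouring_imp_AB_property AB_property_imp_no_odd_closed_walk
      no_odd_closed_walk_imp_two_colouring[OF sym_assoc_adj] by blast
  also have "\<dots> \<longleftrightarrow> (\<exists>c. two_colouring (support M) c)"
    unfolding M_def by (rule two_colouring_assoc_adj_iff_support) fact
  also have "\<dots> \<longleftrightarrow> mset es = mset (map uminus es)"
    using two_colouring_imp_symmetric_spectrum[OF M es(1)]
      symmetric_spectrum_imp_no_odd_closed_walk[OF M nonneg es(1)]
      no_odd_closed_walk_imp_two_colouring[OF sym_support[OF sym]] by blast
  finally show ?thesis
    unfolding odd_coeffs_eq_0_iff_mset_symmetric[OF es]
      eigenvalues_symmetric_iff_mset_symmetric[OF M es(1)] by simp
qed

end
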